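(* Let $p$ be a prime, $r$ an odd positive integer, and $n$ a positive integer with $d_p(n)>0$. Then $A^r_n$ has at least $$\left\lceil \frac{r-u_p(r)+n-1-r\cdot d_p(n)}{p-1}\right\rceil$$ factors of $p$.
   Context: Write $[m]=\{1,2,\ldots,m\}$. For a permutation $\pi$ in the symmetric group $\mathfrak{S}_n$, its descent set is $\mathrm{Des}(\pi)=\{i\in[n-1] : \pi_i>\pi_{i+1}\}$. For $S\subseteq[n-1]$, $\beta_n(S)=|\{\pi\in\mathfrak{S}_n : \mathrm{Des}(\pi)=S\}|$. Define $A^r_n=\sum_{S\subseteq[n-1]}\beta_n(S)^r$. For a positive integer $m$, $u_p(m)$ is the sum of the base $p$ digits of $m$, and $d_p(m)=u_p(m)-1$. An integer $N$ has at least $c$ factors of $p$ if the $p$-adic valuation of $N$ is at least $c$. *)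

theory Defs
  imports Complex_Main "HOL-Combinatorics.Permutations" "HOL-Computational_Algebra.Primes"
begin

definition descent_set :: "nat \<Rightarrow> (nat \<Rightarrow> nat) \<Rightarrow> nat set" where
  "descent_set n \<pi> = {i \<in> {1..n - 1}. \<pi> i > \<pi> (i + 1)}"

definition beta_count :: "nat \<Rightarrow> nat set \<Rightarrow> nat" where
  "beta_count n S = card {\<pi>. \<pi> permutes {1..n} \<and> descent_set n \<pi> = S}"

definition beta_power_sum :: "nat \<Rightarrow> nat \<Rightarrow> nat" where
  "beta_power_sum r n = (\<Sum>S\<in>Pow {1..n - 1}. beta_count n S ^ r)"

(* The base p digit of m at position i is m div p ^ i mod p; it vanishes
   when p ^ i > m. The index set is finite for p \<ge> 2. *)
definition digit_sum :: "nat \<Rightarrow> nat \<Rightarrow> nat" where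
  "digit_sum p m = (\<Sum>i\<in>{i. p ^ i \<le> m}. m div p ^ i mod p)"

definition digit_sum_minus_one :: "nat \<Rightarrow> nat \<Rightarrow> int" where
  "digit_sum_minus_one p m = int (digit_sum p m) - 1"

end

theory Submission
  imports Defs
begin

text \<open>
  Write \<open>\<alpha>(T)\<close> for the number of permutations with descent set contained in \<open>T\<close>. By
  Moebius inversion \<open>\<beta>(S) = (-1)^|S| \<Sum>T\<subseteq>S. (-1)^|T| \<alpha>(T)\<close>, so for odd \<open>r\<close> the power sum is
  \<open>\<Sum>S. (-1)^|S| (\<Sum>T\<subseteq>S. (-1)^|T| \<alpha>(T))^r\<close>. In the expansion of the \<open>r\<close>-th powers, a product of
  \<open>\<alpha>(T)\<close>'s survives the alternating sum over \<open>S\<close> only if the sets \<open>T\<close> cover \<open>[n - 1]\<close>. As \<open>\<alpha>(T)\<close>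
  is a multinomial coefficient with \<open>|T| + 1\<close> parts, Legendre's formula shows that
  \<open>(p - 1) v(\<alpha>(T)) \<ge> |T| - d(n)\<close>, where \<open>v\<close> is the \<open>p\<close>-adic valuation; these bounds yield
  \<open>n - 1 - r d(n)\<close>, and the multiplicities with which products occur yield \<open>r - u(r)\<close>.
\<close>

section \<open>Base p digit sums, Legendre's formula and Kummer's theorem\<close>

lemma digit_sum_0 [simp]: "digit_sum p 0 = 0"
  by (simp add: digit_sum_def)

lemma digit_sum_rec:
  assumes "p \<ge> 2"
  shows "digit_sum p m = m mod p + digit_sum p (m div p)"
proof (cases "m = 0")
  case False
  have fin: "finite {i. p ^ i \<le> k}" for k
  proof (rule finite_subset)
    show "{i. p ^ i \<le> k} \<subseteq> {..k}"
    proof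
      fix i assume "i \<in> {i. p ^ i \<le> k}"
      moreover have "i < p ^ i"
        using assms power_gt_expt[of p i] by simp
      ultimately show "i \<in> {..k}" by simp
    qed
  qed simp
  have iff: "p ^ Suc i \<le> m \<longleftrightarrow> p ^ i \<le> m div p" for i
    using assms by (simp add: less_eq_div_iff_mult_less_eq mult.commute)
  \<comment> \<open>Dropping the last digit lowers every position by one; position 0 belongs to the
    index set because m is nonzero.\<close>
  have "{i. p ^ i \<le> m} = insert 0 (Suc ` {i. p ^ i \<le> m div p})" (is "?L = ?R")
  proof (rule set_eqI)
    fix i show "i \<in> ?L \<longleftrightarrow> i \<in> ?R"
      using False iff by (cases i) (auto simp: image_iff)
  qed
  then have "digit_sum p m = m mod p + (\<Sum>i\<in>Suc ` {i. p ^ i \<le> m div p}. m div p ^ i mod p)"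
    by (simp add: digit_sum_def fin)
  also have "(\<Sum>i\<in>Suc ` {i. p ^ i \<le> m div p}. m div p ^ i mod p) = digit_sum p (m div p)"
    by (simp add: sum.reindex digit_sum_def div_mult2_eq)
  finally show ?thesis .
qed simp

lemma digit_sum_pos:
  assumes "p \<ge> 2" "m > 0"
  shows "digit_sum p m > 0"
  using assms(2)
proof (induction m rule: less_induct)
  case (less m)
  show ?case
  proof (cases "m mod p = 0")
    case True
    then have "0 < m div p" "m div p < m"
      using less.prems assms(1) by auto
    then show ?thesis
      using less.IH digit_sum_rec[OF assms(1), of m] by simp
  qed (use digit_sum_rec[OF assms(1), of m] in simp)
qed

text \<open>Adding 1 turns each trailing digit p - 1 of n into 0 and raises the next digit by 1. The
  number of digits so reset is the valuation of n + 1.\<close>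

lemma digit_sum_Suc:
  assumes "prime p"
  shows "digit_sum p (Suc n) + (p - 1) * multiplicity p (Suc n) = digit_sum p n + 1"
proof (induction n rule: less_induct)
  case (less n)
  have p: "p \<ge> 2" using assms prime_ge_2_nat by blast
  show ?case
  proof (cases "p dvd Suc n")
    case False
    then have "Suc (n mod p) \<noteq> p"
      by (metis mod_Suc mod_eq_0_iff_dvd)
    then have "Suc n mod p = Suc (n mod p)" "Suc n div p = n div p"
      by (auto simp: mod_Suc div_Suc)
    then show ?thesis
      using digit_sum_rec[OF p, of n] digit_sum_rec[OF p, of "Suc n"] False
      by (simp add: not_dvd_imp_multiplicity_0)
  next
    case True
    then obtain k where k: "Suc n = p * k" by blast
    then obtain j where j: "k = Suc j" by (cases k) auto
    \<comment> \<open>The last digit of n is p - 1 and the carry passes from j to j + 1, so the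
      induction hypothesis applies to j.\<close>
    have n: "n = p * j + (p - 1)" using k j p by simp
    have "j \<le> p * j" using p by simp
    then have "j < n" using n p by linarith
    have "digit_sum p n = (p - 1) + digit_sum p j"
    proof -
      have "n mod p = p - 1" "n div p = j"
        unfolding n using p by (simp_all only: mod_mult_self4 div_mult_self4) simp_all
      then show ?thesis using digit_sum_rec[OF p, of n] by simp
    qed
    moreover have "digit_sum p (Suc n) = digit_sum p (Suc j)"
      using digit_sum_rec[OF p, of "Suc n"] p unfolding k j by simp
    moreover have "multiplicity p (Suc n) = Suc (multiplicity p (Suc j))"
      unfolding k j using p assms by (intro multiplicity_times_same) auto
    ultimately show ?thesis
      using less.IH[OF \<open>j < n\<close>] by simp
  qed
qed

text \<open>Legendre's formula, obtained by summing \<open>digit_sum_Suc\<close> over the factors of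
  n!.\<close>

lemma legendre_fact:
  assumes "prime p"
  shows "digit_sum p n + (p - 1) * multiplicity p (fact n :: nat) = n"
proof (induction n)
  case (Suc n)
  have "multiplicity p (fact (Suc n) :: nat) = multiplicity p (Suc n) + multiplicity p (fact n :: nat)"
    using assms by (simp add: prime_elem_multiplicity_mult_distrib del: mult_Suc)
  then show ?case
    using Suc digit_sum_Suc[OF assms, of n] by (simp add: algebra_simps)
qed simp

text \<open>Kummer's theorem in digit-sum form: apply Legendre's formula to n!, k! and (n - k)!,
  whose linear terms cancel.\<close>

lemma kummer_choose:
  assumes "prime p" "k \<le> n"
  shows "digit_sum p n + (p - 1) * multiplicity p (n choose k)
    = digit_sum p k + digit_sum p (n - k)"
proof -
  have "multiplicity p (fact n :: nat)
    = multiplicity p (fact k :: nat) + multiplicity p (fact (n - k) :: nat) + multiplicity p (n choose k)"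
    unfolding binomial_fact_lemma[OF assms(2), symmetric]
    using assms by (simp add: prime_elem_multiplicity_mult_distrib)
  then have "digit_sum p n + ((p - 1) * multiplicity p (fact k :: nat)
    + (p - 1) * multiplicity p (fact (n - k) :: nat) + (p - 1) * multiplicity p (n choose k)) = n"
    using legendre_fact[OF assms(1), of n] by (simp add: distrib_left)
  then show ?thesis
    using legendre_fact[OF assms(1), of k] legendre_fact[OF assms(1), of "n - k"] assms(2)
    by linarith
qed

section \<open>Lower bounds for scaled valuations\<close>

text \<open>Valuations are scaled by \<open>p - 1\<close> because Legendre's formula is then free of division.\<close>

definition scaled_val_ge :: "nat \<Rightarrow> int \<Rightarrow> int \<Rightarrow> bool" where
  "scaled_val_ge p z b \<longleftrightarrow> z = 0 \<or> b \<le> int (p - 1) * int (multiplicity (int p) z)"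

lemma multiplicity_int: "multiplicity (int p) (int m) = multiplicity p m"
  by (simp add: multiplicity_def flip: of_nat_power)

text \<open>Zero has infinite valuation, while \<open>multiplicity\<close> gives it the value 0. The
  disjunct \<open>z = 0\<close> corrects this, so bounds survive cancellation in sums.\<close>

lemma scaled_val_ge_0 [simp]: "scaled_val_ge p 0 b"
  by (simp add: scaled_val_ge_def)

lemma scaled_val_ge_mono: "scaled_val_ge p z b \<Longrightarrow> c \<le> b \<Longrightarrow> scaled_val_ge p z c"
  by (auto simp: scaled_val_ge_def)

lemma scaled_val_ge_add:
  assumes "prime p" "scaled_val_ge p x b" "scaled_val_ge p y b"
  shows "scaled_val_ge p (x + y) b"
proof (cases "x = 0 \<or> y = 0 \<or> x + y = 0")
  case False
  let ?k = "min (multiplicity (int p) x) (multiplicity (int p) y)"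
  have "int p ^ ?k dvd x + y"
    by (intro dvd_add multiplicity_dvd') auto
  then have "?k \<le> multiplicity (int p) (x + y)"
    using False assms(1) by (intro multiplicity_geI) auto
  then have "int (p - 1) * int ?k \<le> int (p - 1) * int (multiplicity (int p) (x + y))"
    by (intro mult_left_mono) auto
  moreover have "b \<le> int (p - 1) * int ?k"
    using assms False by (auto simp: scaled_val_ge_def min_def)
  ultimately show ?thesis
    by (simp add: scaled_val_ge_def)
qed (use assms in \<open>auto simp: scaled_val_ge_def\<close>)

lemma scaled_val_ge_sum:
  assumes "prime p" "\<And>i. i \<in> I \<Longrightarrow> scaled_val_ge p (f i) b"
  shows "scaled_val_ge p (sum f I) b"
  using assms(2) by (induction I rule: infinite_finite_induct) (auto intro: scaled_val_ge_add[OF assms(1)])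

lemma scaled_val_ge_mult:
  assumes "prime p" "scaled_val_ge p x b" "scaled_val_ge p y c"
  shows "scaled_val_ge p (x * y) (b + c)"
proof (cases "x = 0 \<or> y = 0")
  case False
  have "multiplicity (int p) (x * y) = multiplicity (int p) x + multiplicity (int p) y"
    using assms(1) False by (intro prime_elem_multiplicity_mult_distrib) auto
  then show ?thesis
    using assms(2,3) False by (simp add: scaled_val_ge_def distrib_left)
qed auto

lemma scaled_val_ge_power:
  assumes "prime p" "scaled_val_ge p x b"
  shows "scaled_val_ge p (x ^ m) (int m * b)"
proof (induction m)
  case (Suc m)
  then show ?case
    using scaled_val_ge_mult[OF assms Suc] by (simp add: algebra_simps)
qed (simp add: scaled_val_ge_def)

lemma scaled_val_ge_nonneg: "scaled_val_ge p x 0"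
  by (simp add: scaled_val_ge_def)

lemma scaled_val_ge_choose:
  assumes "prime p" "k \<le> n"
  shows "scaled_val_ge p (int (n choose k))
    (int (digit_sum p k) + int (digit_sum p (n - k)) - int (digit_sum p n))"
proof -
  have "int (digit_sum p n) + int (p - 1) * int (multiplicity p (n choose k))
    = int (digit_sum p k) + int (digit_sum p (n - k))"
    using kummer_choose[OF assms] by (metis of_nat_add of_nat_mult)
  then show ?thesis
    by (simp add: scaled_val_ge_def multiplicity_int)
qed

section \<open>Alternating sums of powers over intervals of sets\<close>

text \<open>As many supersets of A inside U have even as odd size. This is what kills the products
  whose sets fail to cover U.\<close>

lemma sum_alternating_interval:
  assumes "finite U" "A \<subset> U"
  shows "(\<Sum>S | A \<subseteq> S \<and> S \<subseteq> U. (-1) ^ card S) = (0 :: int)"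
  using card_subsupersets_even_odd[OF assms] assms
  by (intro sum_alternating_cancels) (auto simp: conj_ac)

text \<open>
  Adjoining a set \<open>T\<close> to \<open>F\<close>, the binomial theorem reduces the sum for \<open>(r, A)\<close> to itself and to the
  sums for \<open>(r - m, A \<union> T)\<close>; the lower end \<open>A\<close> of the interval makes the induction work.
\<close>

lemma scaled_val_alternating_power_sum:
  fixes x :: "'a set \<Rightarrow> int" and d :: int
  assumes p: "prime p" and d: "d \<ge> 1" and U: "finite U" and F: "finite F"
    and x: "\<And>T. T \<in> F \<Longrightarrow> finite T \<and> scaled_val_ge p (x T) (int (card T) - d)"
    and A: "A \<subseteq> U"
  shows "scaled_val_ge p
    (\<Sum>S | A \<subseteq> S \<and> S \<subseteq> U. (-1) ^ card S * (\<Sum>T | T \<in> F \<and> T \<subseteq> S. x T) ^ r)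
    (int r - int (digit_sum p r) - int r * d + int (card U) - int (card A))"
  using F x A
proof (induction F arbitrary: r A rule: finite_induct)
  case empty
  \<comment> \<open>The inner sum is empty and its power is \<open>0 ^ r\<close>, which is 1 for r =
    0. Only r = 0 with A = U leaves a nonzero value, and there the bound is 0.\<close>
  show ?case
  proof (cases "r = 0 \<and> A = U")
    case True
    then have "{S. A \<subseteq> S \<and> S \<subseteq> U} = {U}" by auto
    with True show ?thesis by (simp add: scaled_val_ge_def)
  next
    case False
    then show ?thesis
      using sum_alternating_interval[OF U, of A] empty.prems
      by (cases "r = 0") (auto simp: psubset_eq zero_power)
  qed
next
  case (insert T F)
  define g where "g = (\<lambda>S. \<Sum>T' | T' \<in> F \<and> T' \<subseteq> S. x T')"
  define W where "W = (\<lambda>r A. \<Sum>S | A \<subseteq> S \<and> S \<subseteq> U. (-1) ^ card S * g S ^ r)"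
  define B where "B = (\<lambda>r (A :: 'a set). int r - int (digit_sum p r) - int r * d + int (card U) - int (card A))"
  have IH: "scaled_val_ge p (W r A) (B r A)" if "A \<subseteq> U" for r A
    using insert.IH[OF _ that, of r] insert.prems unfolding W_def B_def g_def by simp
  have finU: "finite {S. A \<subseteq> S \<and> S \<subseteq> U}" for A
    using U by simp
  have g_insert: "(\<Sum>T' | T' \<in> insert T F \<and> T' \<subseteq> S. x T') = (if T \<subseteq> S then x T + g S else g S)" for S
  proof -
    have "{T'. T' \<in> insert T F \<and> T' \<subseteq> S}
      = (if T \<subseteq> S then insert T {T'. T' \<in> F \<and> T' \<subseteq> S} else {T'. T' \<in> F \<and> T' \<subseteq> S})"
      by auto
    then show ?thesis
      using insert.hyps by (simp add: g_def)
  qed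
  define h where "h = (\<lambda>S m. int (r choose m) * x T ^ m * g S ^ (r - m))"
  \<comment> \<open>The term m = 0 is split off because it occurs for every S, whether or not S
    contains T; it gives \<open>W r A\<close>.\<close>
  have pow: "(\<Sum>T' | T' \<in> insert T F \<and> T' \<subseteq> S. x T') ^ r
    = g S ^ r + (if T \<subseteq> S then (\<Sum>m=1..r. h S m) else 0)" for S
  proof -
    have "(x T + g S) ^ r = (\<Sum>m\<le>r. h S m)"
      by (simp add: binomial_ring h_def)
    also have "\<dots> = g S ^ r + (\<Sum>m=1..r. h S m)"
      by (simp add: sum.atMost_shift sum.atLeast1_atMost_eq h_def)
    finally show ?thesis
      unfolding g_insert by simp
  qed
  have "(\<Sum>S | A \<subseteq> S \<and> S \<subseteq> U. (-1) ^ card S * (\<Sum>T' | T' \<in> insert T F \<and> T' \<subseteq> S. x T') ^ r)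
    = W r A + (\<Sum>S | A \<subseteq> S \<and> S \<subseteq> U. (if T \<subseteq> S then (-1) ^ card S * (\<Sum>m=1..r. h S m) else 0))"
    unfolding pow W_def sum.distrib[symmetric] by (intro sum.cong) (auto simp: algebra_simps)
  also have "(\<Sum>S | A \<subseteq> S \<and> S \<subseteq> U. (if T \<subseteq> S then (-1) ^ card S * (\<Sum>m=1..r. h S m) else 0))
    = (\<Sum>S | A \<union> T \<subseteq> S \<and> S \<subseteq> U. (-1) ^ card S * (\<Sum>m=1..r. h S m))"
    using finU[of A] by (subst sum.inter_filter[symmetric]) (auto intro!: sum.cong)
  also have "\<dots> = (\<Sum>m=1..r. int (r choose m) * x T ^ m * W (r - m) (A \<union> T))"
    unfolding W_def h_def sum_distrib_left
    by (subst sum.swap) (simp add: mult_ac)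
  finally have rec: "(\<Sum>S | A \<subseteq> S \<and> S \<subseteq> U. (-1) ^ card S * (\<Sum>T' | T' \<in> insert T F \<and> T' \<subseteq> S. x T') ^ r)
    = W r A + (\<Sum>m=1..r. int (r choose m) * x T ^ m * W (r - m) (A \<union> T))" .
  have "scaled_val_ge p (int (r choose m) * x T ^ m * W (r - m) (A \<union> T)) (B r A)"
    if m: "m \<in> {1..r}" for m
  proof (cases "T \<subseteq> U")
    case False
    then have "{S. A \<union> T \<subseteq> S \<and> S \<subseteq> U} = {}" by auto
    then have "W (r - m) (A \<union> T) = 0" unfolding W_def by (simp only: sum.empty)
    then show ?thesis by simp
  next
    case True
    \<comment> \<open>The hypothesis on \<open>x T\<close> and the trivial bound 0 are combined. For
      empty T the value -d alone would be too weak once m > 1.\<close>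
    define w where "w = max 0 (int (card T) - d)"
    have "scaled_val_ge p (x T) w"
      using insert.prems scaled_val_ge_nonneg[of p "x T"] by (simp add: w_def max_def)
    then have "scaled_val_ge p (int (r choose m) * x T ^ m * W (r - m) (A \<union> T))
      (int (digit_sum p m) + int (digit_sum p (r - m)) - int (digit_sum p r) + int m * w
        + B (r - m) (A \<union> T))"
      using m True insert.prems
      by (intro scaled_val_ge_mult p scaled_val_ge_power scaled_val_ge_choose IH) auto
    moreover have "B r A \<le> int (digit_sum p m) + int (digit_sum p (r - m)) - int (digit_sum p r)
      + int m * w + B (r - m) (A \<union> T)"
    proof -
      have u: "int (digit_sum p m) \<ge> 1"
        using digit_sum_pos[of p m] m prime_ge_2_nat[OF p] by simp
      have c: "int (card (A \<union> T)) \<le> int (card A) + int (card T)"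
        using card_Un_le[of A T] by linarith
      \<comment> \<open>The digit sums of r and r - m cancel in the comparison, and that of m
        supplies the summand 1. For nonempty T, replacing w by |T| - d leaves (m - 1)(|T| -
        1).\<close>
      have "int m * w + int m * d - int m - int (card T) + 1 \<ge> 0"
      proof (cases "card T = 0")
        case True
        \<comment> \<open>Here d \<ge> 1, and hence the positivity of
          \<open>digit_sum_minus_one p n\<close>, enters.\<close>
        have "int m * 1 \<le> int m * d" using d by (intro mult_left_mono) auto
        moreover have "0 \<le> int m * w" by (simp add: w_def)
        ultimately show ?thesis using True by linarith
      next
        case False
        have "int m * (int (card T) - d) \<le> int m * w" by (intro mult_left_mono) (auto simp: w_def)
        moreover have "0 \<le> (int m - 1) * (int (card T) - 1)" using m False by simp
        ultimately show ?thesis by (simp add: algebra_simps)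
      qed
      with u c m show ?thesis
        by (simp add: B_def of_nat_diff algebra_simps)
    qed
    ultimately show ?thesis by (rule scaled_val_ge_mono)
  qed
  then show ?case
    unfolding rec using IH[of A r] insert.prems(2) unfolding B_def
    by (intro scaled_val_ge_add[OF p] scaled_val_ge_sum[OF p]) auto
qed

section \<open>Words with descents only at allowed positions\<close>

text \<open>Lists are indexed from 0 but descents from 1: the comparison of entries \<open>i\<close>
  and \<open>Suc i\<close> is descent position \<open>Suc i\<close>, the length of the prefix before
  the cut. Arbitrary alphabets X let the induction pass to subsets.\<close>

definition arrangements :: "nat set \<Rightarrow> nat set \<Rightarrow> nat list set" where
  "arrangements T X = {xs. distinct xs \<and> set xs = X \<and>
    (\<forall>i. Suc i < length xs \<and> Suc i \<notin> T \<longrightarrow> xs ! i < xs ! Suc i)}"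

lemma finite_arrangements: "finite X \<Longrightarrow> finite (arrangements T X)"
  by (rule finite_subset[OF _ finite_subset_distinct]) (auto simp: arrangements_def)

lemma arrangements_empty:
  assumes "finite X"
  shows "arrangements {} X = {sorted_list_of_set X}"
proof -
  have "xs \<in> arrangements {} X \<longleftrightarrow> sorted_wrt (<) xs \<and> set xs = X" for xs
    by (auto simp: arrangements_def sorted_wrt_iff_nth_Suc_transp[OF transp_on_less]
        dest: strict_sorted_iff[THEN iffD1, OF sorted_wrt_iff_nth_Suc_transp[OF transp_on_less, THEN iffD2]])
  moreover have "sorted_wrt (<) xs \<and> set xs = X \<longleftrightarrow> xs = sorted_list_of_set X" for xs
    using strict_sorted_equal[of xs "sorted_list_of_set X"] assms
    by (auto simp: strict_sorted_list_of_set)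
  ultimately show ?thesis
    by (intro set_eqI) simp
qed

text \<open>Cut each word at the largest allowed descent t. The prefix is an arrangement of its own
  letter set Y; the suffix is increasing, hence determined by Y.\<close>

lemma card_arrangements_split:
  assumes X: "finite X" and t: "0 < t" "t < card X" and T: "\<And>i. i \<in> T \<Longrightarrow> i < t"
  shows "card (arrangements (insert t T) X) = (\<Sum>Y | Y \<subseteq> X \<and> card Y = t. card (arrangements T Y))"
proof -
  let ?D = "SIGMA Y:{Y. Y \<subseteq> X \<and> card Y = t}. arrangements T Y"
  let ?f = "\<lambda>(Y, ys). ys @ sorted_list_of_set (X - Y)"
  let ?g = "\<lambda>xs. (set (take t xs), take t xs)"
  have len: "length ys = card Y" if "ys \<in> arrangements T Y" for T ys Y
    using that distinct_card[of ys] by (auto simp: arrangements_def)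
  have "bij_betw ?f ?D (arrangements (insert t T) X)"
  proof (rule bij_betw_byWitness[where f' = ?g])
    show "\<forall>a\<in>?D. ?g (?f a) = a"
      using len by (auto simp: arrangements_def)
    show "\<forall>xs\<in>arrangements (insert t T) X. ?f (?g xs) = xs"
    proof
      fix xs assume xs: "xs \<in> arrangements (insert t T) X"
      have d: "distinct xs" "set xs = X" using xs by (auto simp: arrangements_def)
      have l: "length xs = card X" using len[OF xs] .
      have "X - set (take t xs) = set (drop t xs)"
        using d by (metis append_take_drop_id distinct_append set_append Diff_cancel Un_Diff Diff_triv Int_commute Un_empty_left)
      moreover have "drop t xs \<in> arrangements {} (set (drop t xs))"
        unfolding arrangements_def
      proof (intro CollectI conjI allI impI)
        fix i assume i: "Suc i < length (drop t xs) \<and> Suc i \<notin> {}"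
        \<comment> \<open>Positions beyond t are not allowed descents, as all of T lies below
          t.\<close>
        then have "Suc (t + i) \<notin> insert t T" using T[of "Suc (t + i)"] by auto
        then show "drop t xs ! i < drop t xs ! Suc i"
          using xs i t by (auto simp: arrangements_def)
      qed (use d in auto)
      ultimately show "?f (?g xs) = xs"
        using arrangements_empty[of "set (drop t xs)"] by simp
    qed
    show "?f ` ?D \<subseteq> arrangements (insert t T) X"
    proof safe
      fix Y ys assume Y: "Y \<subseteq> X" "t = card Y" and ys: "ys \<in> arrangements T Y"
      let ?z = "sorted_list_of_set (X - Y)"
      have z: "?z \<in> arrangements {} (X - Y)" using X arrangements_empty[of "X - Y"] by simp
      have l: "length ys = t" using len[OF ys] Y by simp
      have "ys @ ?z \<in> arrangements (insert t T) X"
        unfolding arrangements_def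
      proof (intro CollectI conjI allI impI)
        fix i assume i: "Suc i < length (ys @ ?z) \<and> Suc i \<notin> insert t T"
        consider "Suc i < t" | "i \<ge> t" using i by force
        then show "(ys @ ?z) ! i < (ys @ ?z) ! Suc i"
        proof cases
          case 1
          then show ?thesis using ys l i by (auto simp: arrangements_def nth_append)
        next
          case 2
          then show ?thesis using z l i by (auto simp: arrangements_def nth_append Suc_diff_le)
        qed
      qed (use Y ys X in \<open>auto simp: arrangements_def\<close>)
      then show "ys @ ?z \<in> arrangements (insert (card Y) T) X" using Y by simp
    qed
    show "?g ` arrangements (insert t T) X \<subseteq> ?D"
    proof safe
      fix xs assume xs: "xs \<in> arrangements (insert t T) X"
      have l: "length xs = card X" using len[OF xs] .
      show "card (set (take t xs)) = t"
        using xs l t by (subst distinct_card) (auto simp: arrangements_def)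
      show "take t xs \<in> arrangements T (set (take t xs))"
        using xs by (auto simp: arrangements_def)
    next
      fix xs y assume xs: "xs \<in> arrangements (insert t T) X" "y \<in> set (take t xs)"
      then show "y \<in> X" using set_take_subset by (fastforce simp: arrangements_def)
    qed
  qed
  then have "card (arrangements (insert t T) X) = card ?D"
    by (simp add: bij_betw_same_card)
  also have "\<dots> = (\<Sum>Y | Y \<subseteq> X \<and> card Y = t. card (arrangements T Y))"
    using X by (subst card_SigmaI) (auto intro: finite_arrangements finite_subset)
  finally show ?thesis .
qed

text \<open>Removing the largest cut t contributes a factor \<open>n choose t\<close>, so the count
  is a multinomial coefficient depending only on |X|. In the bounds the digit sum of t cancels, and
  that of n - t, at least 1, pays for the cut.\<close>

lemma scaled_val_arrangements:
  assumes "prime p" "finite T" "n > 0" "T \<subseteq> {1..<n}"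
  shows "\<exists>c. (\<forall>X. finite X \<and> card X = n \<longrightarrow> card (arrangements T X) = c) \<and>
    scaled_val_ge p (int c) (int (card T) + 1 - int (digit_sum p n))"
  using assms(2-)
proof (induction T arbitrary: n rule: finite_linorder_max_induct)
  case empty
  have "digit_sum p n \<ge> 1"
    using digit_sum_pos[of p n] empty assms(1) prime_ge_2_nat by force
  then show ?case
    by (intro exI[of _ 1]) (auto simp: arrangements_empty scaled_val_ge_def)
next
  case (insert t T)
  then have t: "0 < t" "t < n" by auto
  have "T \<subseteq> {1..<t}" using insert by auto
  from insert.IH[OF t(1) this]
  obtain c where c: "\<forall>X. finite X \<and> card X = t \<longrightarrow> card (arrangements T X) = c"
    and v: "scaled_val_ge p (int c) (int (card T) + 1 - int (digit_sum p t))"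
    by (elim exE conjE)
  have "card (arrangements (insert t T) X) = (n choose t) * c" if X: "finite X" "card X = n" for X
  proof -
    have "card (arrangements (insert t T) X) = (\<Sum>Y | Y \<subseteq> X \<and> card Y = t. card (arrangements T Y))"
      using X t insert.hyps by (intro card_arrangements_split) auto
    also have "\<dots> = (\<Sum>Y | Y \<subseteq> X \<and> card Y = t. c)"
      using finite_subset[OF _ X(1)] by (intro sum.cong refl c[rule_format]) auto
    finally show ?thesis
      using X by (simp add: n_subsets)
  qed
  moreover have "scaled_val_ge p (int ((n choose t) * c))
    (int (card (insert t T)) + 1 - int (digit_sum p n))"
  proof (rule scaled_val_ge_mono)
    show "scaled_val_ge p (int ((n choose t) * c))
      ((int (digit_sum p t) + int (digit_sum p (n - t)) - int (digit_sum p n))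
        + (int (card T) + 1 - int (digit_sum p t)))"
      unfolding of_nat_mult using assms(1) t v
      by (intro scaled_val_ge_mult scaled_val_ge_choose) auto
    have "t \<notin> T" using insert.hyps by blast
    moreover have "digit_sum p (n - t) \<ge> 1"
      using digit_sum_pos[of p "n - t"] t assms(1) prime_ge_2_nat by force
    ultimately show "int (card (insert t T)) + 1 - int (digit_sum p n)
      \<le> (int (digit_sum p t) + int (digit_sum p (n - t)) - int (digit_sum p n))
        + (int (card T) + 1 - int (digit_sum p t))"
      using insert.hyps by simp
  qed
  ultimately show ?case by blast
qed

section \<open>Permutations with descents contained in T\<close>

definition alpha_count :: "nat \<Rightarrow> nat set \<Rightarrow> nat" where
  "alpha_count n T = card {\<pi>. \<pi> permutes {1..n} \<and> descent_set n \<pi> \<subseteq> T}"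

lemma alpha_count_eq_arrangements: "alpha_count n T = card (arrangements T {1..n})"
proof -
  let ?P = "{\<pi>. \<pi> permutes {1..n} \<and> descent_set n \<pi> \<subseteq> T}"
  \<comment> \<open>One-line notation and its inverse; \<open>?g\<close> shifts the index by one and
    is the identity outside {1..n}, as \<open>permutes\<close> demands.\<close>
  let ?f = "\<lambda>\<pi>. map \<pi> [1..<Suc n]"
  let ?g = "\<lambda>xs i. if i \<in> {1..n} then xs ! (i - 1) else (i :: nat)"
  have "bij_betw ?f ?P (arrangements T {1..n})"
  proof (rule bij_betw_byWitness[where f' = ?g])
    show "\<forall>\<pi>\<in>?P. ?g (?f \<pi>) = \<pi>"
      by (auto simp: fun_eq_iff permutes_not_in nth_append simp del: upt_Suc)
    have l: "length xs = n" if "xs \<in> arrangements T {1..n}" for xs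
      using that distinct_card[of xs] by (auto simp: arrangements_def)
    show "\<forall>xs\<in>arrangements T {1..n}. ?f (?g xs) = xs"
      using l by (auto intro!: nth_equalityI simp del: upt_Suc)
    show "?f ` ?P \<subseteq> arrangements T {1..n}"
    proof safe
      fix \<pi> assume \<pi>: "\<pi> permutes {1..n}" "descent_set n \<pi> \<subseteq> T"
      have inj: "inj \<pi>" using \<pi> permutes_inj by blast
      show "?f \<pi> \<in> arrangements T {1..n}"
        unfolding arrangements_def
      proof (intro CollectI conjI allI impI)
        show "distinct (?f \<pi>)" using inj by (simp add: distinct_map inj_on_def del: upt_Suc)
        have "set (?f \<pi>) = \<pi> ` {1..n}" by (simp add: atLeastLessThanSuc_atLeastAtMost del: upt_Suc)
        then show "set (?f \<pi>) = {1..n}" using permutes_image[OF \<pi>(1)] by simp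
        fix i assume i: "Suc i < length (?f \<pi>) \<and> Suc i \<notin> T"
        then have "Suc i \<le> n - 1" by (auto simp del: upt_Suc)
        then have "\<not> \<pi> (Suc i) > \<pi> (Suc (Suc i))"
          using subsetD[OF \<pi>(2), of "Suc i"] i by (auto simp: descent_set_def simp del: upt_Suc)
        moreover have "\<pi> (Suc i) \<noteq> \<pi> (Suc (Suc i))" using inj by (simp add: inj_eq)
        ultimately show "?f \<pi> ! i < ?f \<pi> ! Suc i"
          using i by (simp del: upt_Suc)
      qed
    qed
    show "?g ` arrangements T {1..n} \<subseteq> ?P"
    proof safe
      fix xs assume xs: "xs \<in> arrangements T {1..n}"
      have n: "length xs = n" "distinct xs" "set xs = {1..n}"
        using l[OF xs] xs by (simp_all add: arrangements_def)
      have "bij_betw (\<lambda>i. i - 1) {1..n} {..<n}"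
        by (rule bij_betw_byWitness[where f' = Suc]) auto
      moreover have "bij_betw ((!) xs) {..<n} {1..n}"
        using n by (intro bij_betw_nth) auto
      ultimately have "bij_betw ((!) xs \<circ> (\<lambda>i. i - 1)) {1..n} {1..n}"
        by (rule bij_betw_trans)
      then have "bij_betw (?g xs) {1..n} {1..n}"
        by (rule bij_betw_cong[THEN iffD1, rotated]) auto
      then show "?g xs permutes {1..n}"
        by (rule bij_imp_permutes) auto
    next
      fix xs i assume xs: "xs \<in> arrangements T {1..n}" and i: "i \<in> descent_set n (?g xs)"
      obtain j where j: "i = Suc j" "Suc j < n" "xs ! j > xs ! Suc j"
        using i by (cases i) (auto simp: descent_set_def split: if_splits)
      then show "i \<in> T"
        using xs l[OF xs] by (fastforce simp: arrangements_def)
    qed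
  qed
  then show ?thesis
    unfolding alpha_count_def by (rule bij_betw_same_card)
qed

lemma scaled_val_alpha_count:
  assumes "prime p" "n > 0" "T \<subseteq> {1..n - 1}"
  shows "scaled_val_ge p (int (alpha_count n T)) (int (card T) - digit_sum_minus_one p n)"
proof -
  have "finite T" using assms(3) finite_subset by blast
  moreover have "T \<subseteq> {1..<n}"
    using assms(2) by (intro order_trans[OF assms(3)]) auto
  ultimately have "\<exists>c. (\<forall>X. finite X \<and> card X = n \<longrightarrow> card (arrangements T X) = c) \<and>
    scaled_val_ge p (int c) (int (card T) + 1 - int (digit_sum p n))"
    using assms by (intro scaled_val_arrangements)
  then obtain c where "\<forall>X. finite X \<and> card X = n \<longrightarrow> card (arrangements T X) = c"
    and "scaled_val_ge p (int c) (int (card T) + 1 - int (digit_sum p n))"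
    by (elim exE conjE)
  then show ?thesis
    by (simp add: alpha_count_eq_arrangements digit_sum_minus_one_def algebra_simps)
qed

section \<open>Moebius inversion and the alternating form of the power sum\<close>

lemma alpha_count_eq_sum_beta_count:
  assumes "finite T"
  shows "alpha_count n T = (\<Sum>S\<in>Pow T. beta_count n S)"
proof -
  have fin: "finite {\<pi>. \<pi> permutes {1..n}}" by (simp add: finite_permutations)
  have "{\<pi>. \<pi> permutes {1..n} \<and> descent_set n \<pi> \<subseteq> T}
    = (\<Union>S\<in>Pow T. {\<pi>. \<pi> permutes {1..n} \<and> descent_set n \<pi> = S})"
    by auto
  also have "card \<dots> = (\<Sum>S\<in>Pow T. beta_count n S)"
    unfolding beta_count_def
    using assms by (intro card_UN_disjoint) (auto intro: finite_subset[OF _ fin])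
  finally show ?thesis by (simp add: alpha_count_def)
qed

text \<open>The sign is attached to \<beta> to fit the symmetric form of inclusion-exclusion: there
  it meets a second equal sign, leaving \<alpha> as a plain sum of \<beta>'s.\<close>

lemma beta_count_mobius:
  assumes "finite S"
  shows "(-1) ^ card S * int (beta_count n S) = (\<Sum>T\<in>Pow S. (-1) ^ card T * int (alpha_count n T))"
proof (rule inclusion_exclusion_symmetric[OF _ assms])
  fix S :: "nat set" assume "finite S"
  then show "int (alpha_count n S) = (\<Sum>T\<in>Pow S. (-1) ^ card T * ((-1) ^ card T * int (beta_count n T)))"
    by (simp add: alpha_count_eq_sum_beta_count flip: power_add mult.assoc)
qed

text \<open>For odd r the r-th power of a sign is that sign, so one sign per S remains outside the
  power. The shape is that of \<open>scaled_val_alternating_power_sum\<close> with A empty and F the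
  power set.\<close>

lemma beta_power_sum_alternating:
  assumes "odd r"
  shows "int (beta_power_sum r n) = (\<Sum>S | {} \<subseteq> S \<and> S \<subseteq> {1..n - 1}. (-1) ^ card S *
    (\<Sum>T | T \<in> Pow {1..n - 1} \<and> T \<subseteq> S. (-1) ^ card T * int (alpha_count n T)) ^ r)"
proof -
  have "int (beta_count n S) ^ r = (-1) ^ card S *
    (\<Sum>T | T \<in> Pow {1..n - 1} \<and> T \<subseteq> S. (-1) ^ card T * int (alpha_count n T)) ^ r"
    if S: "S \<subseteq> {1..n - 1}" for S
  proof -
    have "{T. T \<in> Pow {1..n - 1} \<and> T \<subseteq> S} = Pow S" using S by auto
    moreover have "finite S" using S finite_subset by blast
    ultimately have "(\<Sum>T | T \<in> Pow {1..n - 1} \<and> T \<subseteq> S. (-1) ^ card T * int (alpha_count n T)) ^ r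
      = ((-1) ^ card S * int (beta_count n S)) ^ r"
      using beta_count_mobius[of S n] by simp
    also have "\<dots> = (-1) ^ card S * int (beta_count n S) ^ r"
      using assms by (cases "even (card S)") (simp_all add: power_mult_distrib)
    finally show ?thesis by (simp flip: mult.assoc power_add)
  qed
  then show ?thesis
    unfolding beta_power_sum_def of_nat_sum of_nat_power by (intro sum.cong) auto
qed

section \<open>The bound for the power sum\<close>

text \<open>Excludes the case of value 0 in \<open>scaled_val_ge\<close>, so that a genuine bound on
  the multiplicity results. The identity has no descents.\<close>

lemma beta_power_sum_pos: "beta_power_sum r n > 0"
proof -
  have "finite {\<pi>. \<pi> permutes {1..n} \<and> descent_set n \<pi> = {}}"
    by (rule finite_subset[OF _ finite_permutations[of "{1..n}"]]) auto
  moreover have "id \<in> {\<pi>. \<pi> permutes {1..n} \<and> descent_set n \<pi> = {}}"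
    by (auto simp: descent_set_def permutes_id)
  ultimately have "beta_count n {} > 0"
    unfolding beta_count_def card_gt_0_iff by blast
  then show ?thesis
    unfolding beta_power_sum_def by (intro sum_pos2[of _ "{}"]) auto
qed

theorem theorem5p3:
  fixes p r n :: nat
  assumes "prime p" and "odd r" and "n > 0" and "digit_sum_minus_one p n > 0"
  shows "int (multiplicity p (beta_power_sum r n)) \<ge>
    \<lceil>real_of_int (int r - int (digit_sum p r) + int n - 1 - int r * digit_sum_minus_one p n) / (real p - 1)\<rceil>"
proof -
  define b where "b = int r - int (digit_sum p r) + int n - 1 - int r * digit_sum_minus_one p n"
  define v where "v = int (multiplicity p (beta_power_sum r n))"
  have p: "p \<ge> 2" using assms(1) prime_ge_2_nat by blast
  have "scaled_val_ge p ((-1) ^ card T * int (alpha_count n T))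
    (int (card T) - digit_sum_minus_one p n)" if "T \<in> Pow {1..n - 1}" for T
    \<comment> \<open>The sign is given the bound 0, so the product keeps the bound of
      \<alpha>(T).\<close>
    using scaled_val_ge_mult[OF assms(1) scaled_val_ge_nonneg scaled_val_alpha_count[OF assms(1,3)]] that
    by simp
  then have "scaled_val_ge p (int (beta_power_sum r n)) b"
    unfolding beta_power_sum_alternating[OF assms(2)] b_def
    \<comment> \<open>With A empty and U = {1..n - 1}, the term |U| - |A| becomes n - 1.\<close>
    by (intro scaled_val_ge_mono[OF scaled_val_alternating_power_sum[OF assms(1), where d = "digit_sum_minus_one p n"]])
      (use assms in \<open>auto intro: finite_subset simp: of_nat_diff\<close>)
  then have "b \<le> int (p - 1) * v"
    using beta_power_sum_pos[of r n] by (simp add: scaled_val_ge_def multiplicity_int v_def)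
  then have "real_of_int b \<le> real_of_int (int (p - 1) * v)"
    by (simp only: of_int_le_iff)
  then have "real_of_int b / (real p - 1) \<le> real_of_int v"
    using p by (simp add: divide_le_eq of_nat_diff mult.commute)
  then show ?thesis
    unfolding b_def[symmetric] v_def[symmetric] by (simp add: ceiling_le_iff)
qed

end
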